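(* Let $m\ge1$, $h\ge 2$ and $t\geq 1$ be integers. Under the identification of a ruler $(x_0,\dots,x_m)$ with its vector of successive differences $\mathbf{z}=(z_1,\dots,z_m)$, $z_i=x_i-x_{i-1}$, the $B_h$-sets with $m+1$ markings and length $t$ are in bijection with the lattice points (points of $\mathbb{Z}^m$) in the interior of $t\Delta_{m-1}$ that are not contained in any nondegenerate hyperplane of the form $$\sum_{k=1}^{\ell}\Big(\sum_{j\in U_k}z_j\Big)=\sum_{k=\ell+1}^{h'}\Big(\sum_{j\in U_k}z_j\Big),$$ where $0\le\ell\le h'\le h$ and $U_1,\dots,U_{h'}$ are proper consecutive subsets of $[m]$.
   Context: A ruler of length $t$ with $m+1$ markings is a sequence of integers $0=x_0<x_1<\cdots<x_{m-1}<x_m=t$. It is a $B_h$-set if for every pair of distinct sequences $0\le r_1\le\cdots\le r_h\le m$ and $0\le s_1\le\cdots\le s_h\le m$ one has $x_{r_1}+\cdots+x_{r_h}\neq x_{s_1}+\cdots+x_{s_h}$. $[m]=\{1,\dots,m\}$, and $\Delta_{m-1}=\{\mathbf{z}\in\mathbb{R}^m: z_1,\dots,z_m\ge 0,\ \sum_{i=1}^m z_i=1\}$. The interior of $t\Delta_{m-1}$ means its relative interior, $\{\mathbf{z}: z_i>0 \text{ for all } i,\ \sum_i z_i=t\}$. A consecutive subset of $[m]$ is a nonempty set of the form $\{j,j+1,\dots,k\}$; it is proper if it is not equal to $[m]$. The sets $U_k$ need not be distinct; empty sums are $0$. A hyperplane of the displayed form is nondegenerate if its equation is not identically satisfied on $\mathbb{R}^m$.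 *)

theory Defs
  imports Complex_Main "HOL-Library.FuncSet"
begin

text \<open>
  The paper's coordinates are numbered, and consecutive sets of coordinates matter, so
  \<open>\<real>\<^sup>m\<close> is rendered as the set of functions \<open>{1..m} \<rightarrow>\<^sub>E UNIV\<close>.
  Functions are required to be extensional (equal to \<^const>\<open>undefined\<close> off the index set), so
  that a vector, or a ruler, is determined by its entries.
\<close>

definition real_space :: "nat \<Rightarrow> (nat \<Rightarrow> real) set" where
  "real_space m = {1..m} \<rightarrow>\<^sub>E UNIV"

definition integer_lattice :: "nat \<Rightarrow> (nat \<Rightarrow> real) set" where
  "integer_lattice m = {1..m} \<rightarrow>\<^sub>E \<int>"

text \<open>The relative interior of the dilated simplex \<open>t\<Delta>\<^bsub>m-1\<^esub>\<close>.\<close>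

definition dilated_simplex_interior :: "nat \<Rightarrow> real \<Rightarrow> (nat \<Rightarrow> real) set" where
  "dilated_simplex_interior m t =
     {z \<in> real_space m. (\<forall>i\<in>{1..m}. z i > 0) \<and> (\<Sum>i=1..m. z i) = t}"

definition rulers :: "nat \<Rightarrow> int \<Rightarrow> (nat \<Rightarrow> int) set" where
  "rulers m t = {x \<in> {0..m} \<rightarrow>\<^sub>E UNIV. x 0 = 0 \<and> x m = t \<and> strict_mono_on {0..m} x}"

text \<open>Index sequences \<open>0 \<le> r\<^sub>1 \<le> \<dots> \<le> r\<^sub>h \<le> m\<close>.\<close>

definition index_sequences :: "nat \<Rightarrow> nat \<Rightarrow> nat list set" where
  "index_sequences h m = {r. length r = h \<and> sorted r \<and> set r \<subseteq> {0..m}}"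

definition is_Bh_set :: "nat \<Rightarrow> nat \<Rightarrow> (nat \<Rightarrow> int) \<Rightarrow> bool" where
  "is_Bh_set h m x \<longleftrightarrow>
     (\<forall>r\<in>index_sequences h m. \<forall>s\<in>index_sequences h m.
        r \<noteq> s \<longrightarrow> (\<Sum>i\<leftarrow>r. x i) \<noteq> (\<Sum>i\<leftarrow>s. x i))"

definition successive_differences :: "nat \<Rightarrow> (nat \<Rightarrow> int) \<Rightarrow> (nat \<Rightarrow> real)" where
  "successive_differences m x = (\<lambda>i\<in>{1..m}. real_of_int (x i - x (i - 1)))"

definition proper_consecutive :: "nat \<Rightarrow> nat set \<Rightarrow> bool" where
  "proper_consecutive m U \<longleftrightarrow>
     (\<exists>j k. 1 \<le> j \<and> j \<le> k \<and> k \<le> m \<and> U = {j..k}) \<and> U \<noteq> {1..m}"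

text \<open>
  Only \<open>U 1, \<dots>, U n\<close> matter. The two sides may cancel identically, in which case this is all of
  \<open>\<real>\<^sup>m\<close>; \<open>nondegenerate\<close> excludes exactly that.
\<close>

definition hyperplane :: "nat \<Rightarrow> nat \<Rightarrow> nat \<Rightarrow> (nat \<Rightarrow> nat set) \<Rightarrow> (nat \<Rightarrow> real) set" where
  "hyperplane m l n U =
     {z \<in> real_space m. (\<Sum>k=1..l. \<Sum>j\<in>U k. z j) = (\<Sum>k=l+1..n. \<Sum>j\<in>U k. z j)}"

definition nondegenerate :: "nat \<Rightarrow> (nat \<Rightarrow> real) set \<Rightarrow> bool" where
  "nondegenerate m H \<longleftrightarrow> H \<noteq> real_space m"

definition Bh_hyperplanes :: "nat \<Rightarrow> nat \<Rightarrow> (nat \<Rightarrow> real) set set" where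
  "Bh_hyperplanes h m =
     {hyperplane m l n U | l n U.
        l \<le> n \<and> n \<le> h \<and> (\<forall>k\<in>{1..n}. proper_consecutive m (U k)) \<and>
        nondegenerate m (hyperplane m l n U)}"

end

theory Submission
  imports Defs "HOL-Library.Multiset"
begin

text \<open>
  A consecutive set \<open>{a+1..b}\<close> of coordinates contributes \<open>x\<^sub>b - x\<^sub>a\<close>, so a hyperplane equation
  in the differences is an equation \<open>\<Sum>\<^sub>i x(r\<^sub>i) = \<Sum>\<^sub>i x(s\<^sub>i)\<close> for a list of pairs \<open>(r\<^sub>i, s\<^sub>i)\<close>, padded by
  trivial pairs; it is nondegenerate iff the \<open>r\<^sub>i\<close> and the \<open>s\<^sub>i\<close> form different multisets.
  Properness says that \<open>{r\<^sub>i, s\<^sub>i} \<noteq> {0, m}\<close>. For a coincidence of sums this is automatic when both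
  sequences are sorted: if \<open>r\<^sub>i = 0\<close> and \<open>s\<^sub>i = m\<close>, then \<open>x(r\<^sub>k) = 0\<close> for \<open>k \<le> i\<close> and
  \<open>x(s\<^sub>k) = t\<close> for \<open>k \<ge> i\<close>, so the second sum dominates the first termwise, strictly at \<open>k = i\<close>.
\<close>

section \<open>Partial sums and consecutive sets of coordinates\<close>

definition partial_sum :: "(nat \<Rightarrow> real) \<Rightarrow> nat \<Rightarrow> real" where
  "partial_sum z i = (\<Sum>j=1..i. z j)"

lemma partial_sum_0 [simp]: "partial_sum z 0 = 0"
  by (simp add: partial_sum_def)

lemma partial_sum_Suc [simp]: "partial_sum z (Suc i) = partial_sum z i + z (Suc i)"
  by (simp add: partial_sum_def)

lemma sum_eq_partial_sum_diff:
  assumes "a \<le> b"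
  shows "(\<Sum>j=Suc a..b. z j) = partial_sum z b - partial_sum z a"
  using assms by (induction b rule: dec_induct) auto

text \<open>Replacing the left end \<open>j\<close> by \<open>a = j - 1\<close> turns an interval of
  coordinates into a pair of markings in 0..m, and the excluded set \<open>{1..m}\<close> into the
  pair \<open>(0, m)\<close>.\<close>

lemma proper_consecutive_iff:
  assumes "m \<ge> 1"
  shows "proper_consecutive m U \<longleftrightarrow>
    (\<exists>a b. a < b \<and> b \<le> m \<and> (a, b) \<noteq> (0, m) \<and> U = {Suc a..b})"
proof
  assume "proper_consecutive m U"
  then obtain j k where jk: "1 \<le> j" "j \<le> k" "k \<le> m" "U = {j..k}" "U \<noteq> {1..m}"
    unfolding proper_consecutive_def by blast
  then have "j - 1 < k \<and> k \<le> m \<and> (j - 1, k) \<noteq> (0, m) \<and> U = {Suc (j - 1)..k}"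
    by auto
  then show "\<exists>a b. a < b \<and> b \<le> m \<and> (a, b) \<noteq> (0, m) \<and> U = {Suc a..b}"
    by blast
next
  assume "\<exists>a b. a < b \<and> b \<le> m \<and> (a, b) \<noteq> (0, m) \<and> U = {Suc a..b}"
  then obtain a b where ab: "a < b" "b \<le> m" "(a, b) \<noteq> (0, m)" "U = {Suc a..b}"
    by blast
  then have "U \<noteq> {1..m}"
    by (auto simp: Icc_eq_Icc)
  moreover have "1 \<le> Suc a \<and> Suc a \<le> b \<and> b \<le> m \<and> U = {Suc a..b}"
    using ab by auto
  ultimately show "proper_consecutive m U"
    unfolding proper_consecutive_def by blast
qed

section \<open>Hyperplanes as lists of pairs of markings\<close>

definition pair_hyperplane :: "nat \<Rightarrow> (nat \<times> nat) list \<Rightarrow> (nat \<Rightarrow> real) set" where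
  "pair_hyperplane m ps =
     {z \<in> real_space m. (\<Sum>p\<leftarrow>ps. partial_sum z (fst p)) = (\<Sum>p\<leftarrow>ps. partial_sum z (snd p))}"

text \<open>The order of a pair only records the side of the equation on which its interval stands,
  so the full interval has to be excluded in both orders.\<close>

definition proper_pair :: "nat \<Rightarrow> nat \<times> nat \<Rightarrow> bool" where
  "proper_pair m p \<longleftrightarrow> fst p \<le> m \<and> snd p \<le> m \<and> p \<noteq> (0, m) \<and> p \<noteq> (m, 0)"

text \<open>The offset \<open>d\<close> serves both sides of a hyperplane equation: the left one is
  numbered from 1 (\<open>d = 0\<close>), the right one from \<open>l + 1\<close>
  (\<open>d = l\<close>).\<close>

lemma sum_nth_pred_eq_sum_list:
  fixes f :: "'a \<Rightarrow> real"
  shows "(\<Sum>k=Suc d..d + length xs. f (xs ! (k - Suc d))) = (\<Sum>x\<leftarrow>xs. f x)"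
proof -
  have "(\<Sum>k=Suc d..d + length xs. f (xs ! (k - Suc d))) = (\<Sum>i<length xs. f (xs ! i))"
    by (rule sum.reindex_bij_witness[where i = "\<lambda>i. Suc (d + i)" and j = "\<lambda>k. k - Suc d"]) auto
  then show ?thesis
    by (simp add: sum_list_sum_nth atLeast0LessThan)
qed

lemma hyperplane_eq_pair_hyperplane:
  assumes "m \<ge> 1" "l \<le> n" "n \<le> h" "\<forall>k\<in>{1..n}. proper_consecutive m (U k)"
  obtains ps where "length ps = h" "\<forall>p\<in>set ps. proper_pair m p"
    "hyperplane m l n U = pair_hyperplane m ps"
proof -
  have "\<forall>k\<in>{1..n}. \<exists>a b. a < b \<and> b \<le> m \<and> (a, b) \<noteq> (0, m) \<and> U k = {Suc a..b}"
    using assms proper_consecutive_iff by blast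
  then obtain a b where ab:
    "\<And>k. k \<in> {1..n} \<Longrightarrow> a k < b k \<and> b k \<le> m \<and> (a k, b k) \<noteq> (0, m) \<and> U k = {Suc (a k)..b k}"
    by metis
  \<comment> \<open>A pair contributes \<open>?X (fst p) - ?X (snd p)\<close> to left minus right,
    so sets on the left put the larger marking first and sets on the right put it second.\<close>
  define pair where "pair k = (if k \<le> l then (b k, a k) else (a k, b k))" for k
  \<comment> \<open>The pairs \<open>(0, 0)\<close> fill the list up to length exactly
    \<open>h\<close>; they contribute 0 and are proper because m \<ge> 1.\<close>
  define ps where "ps = map pair [Suc 0..<Suc n] @ replicate (h - n) (0, 0)"
  have proper: "\<forall>p\<in>set ps. proper_pair m p"
    using ab assms(1) by (fastforce simp: ps_def pair_def proper_pair_def)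
  have "z \<in> hyperplane m l n U \<longleftrightarrow> z \<in> pair_hyperplane m ps" for z
  proof -
    let ?X = "partial_sum z"
    have split: "(\<Sum>k=1..n. g k) = (\<Sum>k=1..l. g k) + (\<Sum>k=l+1..n. g k)" for g :: "nat \<Rightarrow> real"
      using assms(2) sum.ub_add_nat[of 1 l g "n - l"] by simp
    have U: "(\<Sum>j\<in>U k. z j) = ?X (b k) - ?X (a k)" if "k \<in> {1..n}" for k
      using ab[OF that] sum_eq_partial_sum_diff[of "a k" "b k" z] by simp
    have left: "(\<Sum>k=1..l. \<Sum>j\<in>U k. z j) = (\<Sum>k=1..l. ?X (fst (pair k)) - ?X (snd (pair k)))"
      using assms(2) by (intro sum.cong) (auto simp: U pair_def)
    have right: "(\<Sum>k=l+1..n. \<Sum>j\<in>U k. z j) = - (\<Sum>k=l+1..n. ?X (fst (pair k)) - ?X (snd (pair k)))"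
      unfolding sum_negf[symmetric] by (intro sum.cong) (auto simp: U pair_def)
    have "(\<Sum>p\<leftarrow>ps. ?X (fst p)) - (\<Sum>p\<leftarrow>ps. ?X (snd p))
        = (\<Sum>k=1..n. ?X (fst (pair k)) - ?X (snd (pair k)))"
      by (simp add: ps_def sum_list_replicate interv_sum_list_conv_sum_set_nat comp_def
          sum_subtractf atLeastLessThanSuc_atLeastAtMost del: upt_Suc)
    then show ?thesis
      unfolding hyperplane_def pair_hyperplane_def mem_Collect_eq left right
      using split[of "\<lambda>k. ?X (fst (pair k)) - ?X (snd (pair k))"] by auto
  qed
  with proper show thesis
    using assms(3) by (intro that[of ps]) (auto simp: ps_def)
qed

lemma pair_hyperplane_eq_hyperplane:
  assumes "m \<ge> 1" "\<forall>p\<in>set ps. proper_pair m p"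
  obtains l n U where "l \<le> n" "n \<le> length ps" "\<forall>k\<in>{1..n}. proper_consecutive m (U k)"
    "pair_hyperplane m ps = hyperplane m l n U"
proof -
  \<comment> \<open>Decreasing pairs are swapped and go to the left side, increasing ones go to the
    right side. Pairs with equal entries are dropped, as they would give empty intervals and
    contribute 0; hence \<open>n\<close> may be smaller than \<open>length ps\<close>.\<close>
  define P where "P = map (\<lambda>p. (snd p, fst p)) (filter (\<lambda>p. snd p < fst p) ps)"
  define Q where "Q = filter (\<lambda>p. fst p < snd p) ps"
  define l where "l = length P"
  define n where "n = length P + length Q"
  define U where "U k = (case (P @ Q) ! (k - 1) of (a, b) \<Rightarrow> {Suc a..b})" for k
  have n: "n \<le> length ps"
    unfolding n_def P_def Q_def by (induction ps) auto
  have PQ: "fst p < snd p \<and> snd p \<le> m \<and> p \<noteq> (0, m)" if "p \<in> set (P @ Q)" for p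
    using that assms(2) by (auto simp: P_def Q_def proper_pair_def)
  have "proper_consecutive m (U k)" if "k \<in> {1..n}" for k
  proof -
    have "(P @ Q) ! (k - 1) \<in> set (P @ Q)"
      using that by (intro nth_mem) (auto simp: n_def)
    from PQ[OF this] show ?thesis
      unfolding proper_consecutive_iff[OF assms(1)] U_def by (auto split: prod.split)
  qed
  moreover have "z \<in> pair_hyperplane m ps \<longleftrightarrow> z \<in> hyperplane m l n U" for z
  proof -
    let ?X = "partial_sum z"
    define f where "f p = (\<Sum>j=Suc (fst p)..snd p. z j)" for p
    have f: "f p = ?X (snd p) - ?X (fst p)" if "fst p < snd p" for p
      using that sum_eq_partial_sum_diff[of "fst p" "snd p" z] by (simp add: f_def)
    have "(\<Sum>k=1..l. \<Sum>j\<in>U k. z j) = (\<Sum>k=Suc 0..0 + length P. f (P ! (k - Suc 0)))"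
      by (intro sum.cong) (auto simp: l_def U_def f_def nth_append split: prod.split)
    then have left: "(\<Sum>k=1..l. \<Sum>j\<in>U k. z j) = (\<Sum>p\<leftarrow>P. f p)"
      by (simp only: sum_nth_pred_eq_sum_list)
    have "(\<Sum>k=l+1..n. \<Sum>j\<in>U k. z j) = (\<Sum>k=Suc l..l + length Q. f (Q ! (k - Suc l)))"
      by (intro sum.cong) (auto simp: l_def n_def U_def f_def nth_append split: prod.split)
    then have right: "(\<Sum>k=l+1..n. \<Sum>j\<in>U k. z j) = (\<Sum>p\<leftarrow>Q. f p)"
      by (simp only: sum_nth_pred_eq_sum_list)
    have "(\<Sum>p\<leftarrow>P. f p) - (\<Sum>p\<leftarrow>Q. f p) = (\<Sum>p\<leftarrow>ps. ?X (fst p)) - (\<Sum>p\<leftarrow>ps. ?X (snd p))"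
      unfolding P_def Q_def
    proof (induction ps)
      case (Cons p ps)
      consider "fst p < snd p" | "fst p = snd p" | "snd p < fst p"
        by linarith
      then show ?case
        using Cons f[of p] f[of "(snd p, fst p)"] by cases auto
    qed simp
    then show ?thesis
      unfolding hyperplane_def pair_hyperplane_def mem_Collect_eq left right by auto
  qed
  ultimately show thesis
    using n by (intro that[of l n U]) (auto simp: l_def n_def)
qed

lemma Bh_hyperplanes_eq:
  assumes "m \<ge> 1"
  shows "Bh_hyperplanes h m =
    {pair_hyperplane m ps | ps. length ps = h \<and> (\<forall>p\<in>set ps. proper_pair m p) \<and>
       pair_hyperplane m ps \<noteq> real_space m}"
proof (intro equalityI subsetI)
  fix H assume "H \<in> Bh_hyperplanes h m"
  then obtain l n U where H: "H = hyperplane m l n U" "l \<le> n" "n \<le> h"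
    "\<forall>k\<in>{1..n}. proper_consecutive m (U k)" "H \<noteq> real_space m"
    unfolding Bh_hyperplanes_def nondegenerate_def by auto
  show "H \<in> {pair_hyperplane m ps | ps. length ps = h \<and> (\<forall>p\<in>set ps. proper_pair m p) \<and>
       pair_hyperplane m ps \<noteq> real_space m}"
    by (rule hyperplane_eq_pair_hyperplane[OF assms H(2-4)]) (use H in auto)
next
  fix H assume "H \<in> {pair_hyperplane m ps | ps. length ps = h \<and> (\<forall>p\<in>set ps. proper_pair m p) \<and>
       pair_hyperplane m ps \<noteq> real_space m}"
  then obtain ps where ps: "H = pair_hyperplane m ps" "length ps = h"
    "\<forall>p\<in>set ps. proper_pair m p" "H \<noteq> real_space m"
    by blast
  obtain l n U where "l \<le> n" "n \<le> length ps" "\<forall>k\<in>{1..n}. proper_consecutive m (U k)"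
    "pair_hyperplane m ps = hyperplane m l n U"
    by (rule pair_hyperplane_eq_hyperplane[OF assms ps(3)])
  then show "H \<in> Bh_hyperplanes h m"
    unfolding Bh_hyperplanes_def nondegenerate_def using ps by blast
qed

section \<open>Nondegeneracy as inequality of multisets\<close>

lemma sum_list_map_cong_mset:
  fixes f :: "'a \<Rightarrow> 'b::comm_monoid_add"
  assumes "mset xs = mset ys"
  shows "(\<Sum>x\<leftarrow>xs. f x) = (\<Sum>x\<leftarrow>ys. f x)"
  using assms by (simp flip: sum_mset_sum_list)

text \<open>Equal multisets give equal sums for every \<open>z\<close>. If instead some marking
  \<open>c\<close> has different multiplicities, a vector whose partial sums are the indicator of
  \<open>c\<close> up to a constant violates the equation, because its two sides then count
  \<open>c\<close>.\<close>

lemma pair_hyperplane_nondegenerate_iff: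
  assumes "\<forall>p\<in>set ps. fst p \<le> m \<and> snd p \<le> m"
  shows "pair_hyperplane m ps \<noteq> real_space m \<longleftrightarrow> mset (map fst ps) \<noteq> mset (map snd ps)"
proof
  assume "pair_hyperplane m ps \<noteq> real_space m"
  then obtain z where
    "(\<Sum>p\<leftarrow>ps. partial_sum z (fst p)) \<noteq> (\<Sum>p\<leftarrow>ps. partial_sum z (snd p))"
    unfolding pair_hyperplane_def by blast
  then show "mset (map fst ps) \<noteq> mset (map snd ps)"
    using sum_list_map_cong_mset[of "map fst ps" "map snd ps" "partial_sum z"]
    by (auto simp: comp_def)
next
  assume "mset (map fst ps) \<noteq> mset (map snd ps)"
  then obtain c where c: "count (mset (map fst ps)) c \<noteq> count (mset (map snd ps)) c"
    by (auto simp: multiset_eq_iff)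
  define X where "X i = (of_bool (i = c) :: real)" for i :: nat
  define z where "z = (\<lambda>i\<in>{1..m}. X i - X (i - 1))"
  have z: "z \<in> real_space m"
    by (simp add: z_def real_space_def)
  \<comment> \<open>Partial sums start at 0, which forces the shift by \<open>X 0\<close> (nonzero
    only for \<open>c = 0\<close>). It cancels later, since both sides have \<open>length ps\<close>
    terms.\<close>
  have X: "partial_sum z i = X i - X 0" if "i \<le> m" for i
    using that by (induction i) (auto simp: z_def)
  have count: "(\<Sum>x\<leftarrow>xs. X x) = count (mset xs) c" for xs
    by (induction xs) (auto simp: X_def)
  have "(\<Sum>p\<leftarrow>ps. partial_sum z (fst p)) = (\<Sum>p\<leftarrow>ps. X (fst p) - X 0)"
    using assms by (intro arg_cong[where f = sum_list] map_cong) (auto simp: X)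
  moreover have "(\<Sum>p\<leftarrow>ps. partial_sum z (snd p)) = (\<Sum>p\<leftarrow>ps. X (snd p) - X 0)"
    using assms by (intro arg_cong[where f = sum_list] map_cong) (auto simp: X)
  ultimately have "(\<Sum>p\<leftarrow>ps. partial_sum z (fst p)) \<noteq> (\<Sum>p\<leftarrow>ps. partial_sum z (snd p))"
    using c count[of "map fst ps"] count[of "map snd ps"]
    by (simp add: sum_list_subtractf comp_def)
  with z show "pair_hyperplane m ps \<noteq> real_space m"
    unfolding pair_hyperplane_def by blast
qed

section \<open>Coincidences of sums in a ruler\<close>

lemma ruler_bounds:
  assumes "x \<in> rulers m t" "i \<le> m"
  shows "0 \<le> x i" "x i \<le> t"
proof -
  have "mono_on {0..m} x" "x 0 = 0" "x m = t"
    using assms(1) strict_mono_on_imp_mono_on by (auto simp: rulers_def)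
  then show "0 \<le> x i" "x i \<le> t"
    using assms(2) mono_onD[of "{0..m}" x 0 i] mono_onD[of "{0..m}" x i m] by auto
qed

lemma sorted_coincidence_not_extreme:
  assumes x: "x \<in> rulers m t" and t: "t \<ge> 1"
    and r: "r \<in> index_sequences h m" and s: "s \<in> index_sequences h m"
    and eq: "(\<Sum>i\<leftarrow>r. x i) = (\<Sum>i\<leftarrow>s. x i)" and i: "i < h"
  shows "\<not> (r ! i = 0 \<and> s ! i = m)"
proof
  assume ri: "r ! i = 0 \<and> s ! i = m"
  have x0: "x 0 = 0" "x m = t"
    using x by (auto simp: rulers_def)
  have len: "length r = h" "length s = h" "sorted r" "sorted s"
    using r s by (auto simp: index_sequences_def)
  have le: "r ! k \<le> m" "s ! k \<le> m" if "k < h" for k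
  proof -
    have "r ! k \<in> set r" "s ! k \<in> set s"
      using that len by auto
    then show "r ! k \<le> m" "s ! k \<le> m"
      using r s unfolding index_sequences_def by force+
  qed
  have "x (r ! k) \<le> x (s ! k)" if "k < h" for k
  proof (cases "k \<le> i")
    case True
    then have "r ! k \<le> r ! i"
      using len i by (intro sorted_nth_mono) auto
    then show ?thesis
      using ri x0 ruler_bounds(1)[OF x] le that by simp
  next
    case False
    then have "s ! i \<le> s ! k"
      using len that by (intro sorted_nth_mono) auto
    then have "s ! k = m"
      using ri le(2)[OF that] by simp
    then show ?thesis
      using x0 ruler_bounds(2)[OF x] le that by simp
  qed
  moreover have "x (r ! i) < x (s ! i)"
    using ri x0 t by simp
  ultimately have "(\<Sum>k<h. x (r ! k)) < (\<Sum>k<h. x (s ! k))"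
    using i by (intro sum_strict_mono_ex1) auto
  then show False
    using eq len by (simp add: sum_list_sum_nth atLeast0LessThan)
qed

text \<open>Two sorted index sequences with the same sum are zipped into a list of pairs.
  Conversely, the two columns of a list of pairs are sorted separately: this destroys the pairing
  but keeps both sums and both multisets.\<close>

lemma not_is_Bh_set_iff:
  assumes x: "x \<in> rulers m t" and t: "t \<ge> 1"
  shows "\<not> is_Bh_set h m x \<longleftrightarrow>
    (\<exists>ps. length ps = h \<and> (\<forall>p\<in>set ps. proper_pair m p) \<and>
      mset (map fst ps) \<noteq> mset (map snd ps) \<and> (\<Sum>p\<leftarrow>ps. x (fst p)) = (\<Sum>p\<leftarrow>ps. x (snd p)))"
    (is "_ \<longleftrightarrow> ?R")
proof
  assume "\<not> is_Bh_set h m x"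
  then obtain r s where r: "r \<in> index_sequences h m" and s: "s \<in> index_sequences h m"
    and "r \<noteq> s" and eq: "(\<Sum>i\<leftarrow>r. x i) = (\<Sum>i\<leftarrow>s. x i)"
    unfolding is_Bh_set_def by blast
  have len: "length r = h" "length s = h" "sorted r" "sorted s"
    using r s by (auto simp: index_sequences_def)
  \<comment> \<open>A sorted list is determined by its multiset.\<close>
  have "mset r \<noteq> mset s"
    using \<open>r \<noteq> s\<close> len by (metis properties_for_sort)
  have "proper_pair m p" if p: "p \<in> set (zip r s)" for p
  proof -
    obtain i where i: "i < h" "p = (r ! i, s ! i)"
      using p len by (auto simp: set_zip)
    \<comment> \<open>The pair \<open>(m, 0)\<close> is excluded by the same lemma with
      \<open>r\<close> and \<open>s\<close> exchanged.\<close>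
    then have "p \<noteq> (0, m) \<and> p \<noteq> (m, 0)"
      using sorted_coincidence_not_extreme[OF x t r s eq]
        sorted_coincidence_not_extreme[OF x t s r eq[symmetric]] by auto
    moreover have "r ! i \<in> set r" "s ! i \<in> set s"
      using i len by auto
    then have "r ! i \<le> m" "s ! i \<le> m"
      using r s unfolding index_sequences_def by force+
    ultimately show ?thesis
      using i by (simp add: proper_pair_def)
  qed
  moreover have "(\<Sum>i\<leftarrow>map fst (zip r s). x i) = (\<Sum>i\<leftarrow>map snd (zip r s). x i)"
    using len eq by simp
  then have "(\<Sum>p\<leftarrow>zip r s. x (fst p)) = (\<Sum>p\<leftarrow>zip r s. x (snd p))"
    by (simp only: map_map comp_def)
  ultimately show ?R
    using len \<open>mset r \<noteq> mset s\<close> by (intro exI[of _ "zip r s"]) auto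
next
  assume ?R
  then obtain ps where ps: "length ps = h" "\<forall>p\<in>set ps. proper_pair m p"
    "mset (map fst ps) \<noteq> mset (map snd ps)" "(\<Sum>p\<leftarrow>ps. x (fst p)) = (\<Sum>p\<leftarrow>ps. x (snd p))"
    by blast
  let ?r = "sort (map fst ps)" and ?s = "sort (map snd ps)"
  have sort: "(\<Sum>i\<leftarrow>sort xs. x i) = (\<Sum>i\<leftarrow>xs. x i)" for xs
    by (rule sum_list_map_cong_mset) simp
  have "?r \<in> index_sequences h m" "?s \<in> index_sequences h m"
    using ps(1,2) by (auto simp: index_sequences_def proper_pair_def)
  moreover have "?r \<noteq> ?s"
    using ps(3) by (metis mset_sort)
  moreover have "(\<Sum>i\<leftarrow>?r. x i) = (\<Sum>i\<leftarrow>?s. x i)"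
    using ps(4) by (simp add: sort comp_def)
  ultimately show "\<not> is_Bh_set h m x"
    unfolding is_Bh_set_def by blast
qed

section \<open>Passing between rulers and lattice points\<close>

lemma partial_sum_successive_differences:
  assumes "x \<in> rulers m t" "i \<le> m"
  shows "partial_sum (successive_differences m x) i = x i"
  using assms(2)
proof (induction i)
  case 0
  then show ?case
    using assms(1) by (simp add: rulers_def)
qed (simp add: successive_differences_def)

lemma is_Bh_set_iff_avoids_hyperplanes:
  assumes m: "m \<ge> 1" and x: "x \<in> rulers m t" and t: "t \<ge> 1"
  shows "is_Bh_set h m x \<longleftrightarrow> (\<forall>H\<in>Bh_hyperplanes h m. successive_differences m x \<notin> H)"
proof -
  let ?z = "successive_differences m x"
  have "?z \<in> real_space m"
    by (simp add: successive_differences_def real_space_def)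
  have mem: "?z \<in> pair_hyperplane m ps \<longleftrightarrow> (\<Sum>p\<leftarrow>ps. x (fst p)) = (\<Sum>p\<leftarrow>ps. x (snd p))"
    if ps: "\<forall>p\<in>set ps. proper_pair m p" for ps
  proof -
    \<comment> \<open>The projection \<open>g\<close> is left open so that one induction covers
      \<open>fst\<close> and \<open>snd\<close>.\<close>
    have "(\<Sum>p\<leftarrow>ps. partial_sum ?z (g p)) = of_int (\<Sum>p\<leftarrow>ps. x (g p))"
      if "\<forall>p\<in>set ps. g p \<le> m" for g
      using that by (induction ps) (auto simp: partial_sum_successive_differences[OF x])
    from this[of fst] this[of snd] show ?thesis
      using ps \<open>?z \<in> real_space m\<close> by (simp add: pair_hyperplane_def proper_pair_def)
  qed
  have nondeg: "pair_hyperplane m ps \<noteq> real_space m \<longleftrightarrow> mset (map fst ps) \<noteq> mset (map snd ps)"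
    if "\<forall>p\<in>set ps. proper_pair m p" for ps
    using that by (intro pair_hyperplane_nondegenerate_iff) (auto simp: proper_pair_def)
  have "(\<exists>H\<in>Bh_hyperplanes h m. ?z \<in> H) \<longleftrightarrow>
    (\<exists>ps. length ps = h \<and> (\<forall>p\<in>set ps. proper_pair m p) \<and>
      pair_hyperplane m ps \<noteq> real_space m \<and> ?z \<in> pair_hyperplane m ps)"
    unfolding Bh_hyperplanes_eq[OF m] by fast
  also have "\<dots> \<longleftrightarrow> \<not> is_Bh_set h m x"
    unfolding not_is_Bh_set_iff[OF x t] by (intro ex_cong1 conj_cong refl) (simp_all only: mem nondeg)
  finally show ?thesis
    by blast
qed

text \<open>Partial sums invert the differences: integrality of \<open>z\<close> makes them
  integers, positivity makes them strictly increasing, and the total \<open>t\<close> is the last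
  marking.\<close>

lemma bij_betw_successive_differences:
  assumes m: "m \<ge> 1"
  shows "bij_betw (successive_differences m) (rulers m t)
    (integer_lattice m \<inter> dilated_simplex_interior m (real_of_int t))"
proof (rule bij_betw_imageI)
  show "inj_on (successive_differences m) (rulers m t)"
  proof (rule inj_onI)
    fix x y assume x: "x \<in> rulers m t" and y: "y \<in> rulers m t"
      and "successive_differences m x = successive_differences m y"
    then have "x i = y i" if "i \<le> m" for i
      using partial_sum_successive_differences[OF x that]
        partial_sum_successive_differences[OF y that] by simp
    moreover have "x \<in> {0..m} \<rightarrow>\<^sub>E UNIV" "y \<in> {0..m} \<rightarrow>\<^sub>E UNIV"
      using x y by (auto simp: rulers_def)
    ultimately show "x = y"
      by (intro PiE_ext[of x "{0..m}" _ y]) auto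
  qed
  show "successive_differences m ` rulers m t =
    integer_lattice m \<inter> dilated_simplex_interior m (real_of_int t)"
  proof (intro equalityI subsetI)
    fix z assume "z \<in> successive_differences m ` rulers m t"
    then obtain x where x: "x \<in> rulers m t" and z: "z = successive_differences m x"
      by blast
    have "(\<Sum>i=1..m. z i) = t"
      using partial_sum_successive_differences[OF x, of m] x
      by (simp add: z partial_sum_def rulers_def)
    moreover have "z i > 0" if "i \<in> {1..m}" for i
    proof -
      have "x (i - 1) < x i"
        using x that by (auto simp: rulers_def intro: strict_mono_onD)
      then show ?thesis
        using that by (simp add: z successive_differences_def)
    qed
    ultimately show "z \<in> integer_lattice m \<inter> dilated_simplex_interior m (real_of_int t)"
      by (auto simp: z integer_lattice_def dilated_simplex_interior_def real_space_def
          successive_differences_def)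
  next
    fix z assume z: "z \<in> integer_lattice m \<inter> dilated_simplex_interior m (real_of_int t)"
    then have ints: "z i \<in> \<int>" and pos: "z i > 0" if "i \<in> {1..m}" for i
      using that by (auto simp: integer_lattice_def dilated_simplex_interior_def)
    \<comment> \<open>The floor only changes the type from real to int: \<open>xz\<close> shows that
      nothing is rounded.\<close>
    define x where "x = (\<lambda>i\<in>{0..m}. \<lfloor>partial_sum z i\<rfloor>)"
    have xz: "of_int (x i) = partial_sum z i" if "i \<le> m" for i
    proof -
      have "partial_sum z i \<in> \<int>"
        unfolding partial_sum_def using that by (intro Ints_sum ints) auto
      then show ?thesis
        using that by (simp add: x_def of_int_floor)
    qed
    have step: "of_int (x i - x (i - 1)) = z i" if "i \<in> {1..m}" for i
    proof -
      have "i - 1 \<le> m" "i \<le> m" "Suc (i - 1) = i"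
        using that by auto
      then show ?thesis
        using xz[of i] xz[of "i - 1"] partial_sum_Suc[of z "i - 1"] by (simp del: partial_sum_Suc)
    qed
    have "x i < x j" if "i < j" "j \<le> m" for i j
    proof -
      have "0 < (\<Sum>k=Suc i..j. z k)"
        using that by (intro sum_pos pos) auto
      then have "real_of_int (x i) < of_int (x j)"
        using that xz[of i] xz[of j] sum_eq_partial_sum_diff[of i j z] by simp
      then show ?thesis
        by simp
    qed
    moreover have "real_of_int (x m) = of_int t"
      using z xz[of m] by (simp add: dilated_simplex_interior_def partial_sum_def)
    ultimately have "x \<in> rulers m t"
      by (auto simp: rulers_def x_def strict_mono_on_def)
    moreover have "successive_differences m x = z"
      using z step
      by (auto simp: successive_differences_def integer_lattice_def fun_eq_iff PiE_def extensional_def)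
    ultimately show "z \<in> successive_differences m ` rulers m t"
      by blast
  qed
qed

theorem proposition3p3:
  fixes m h :: nat and t :: int
  assumes "m \<ge> 1" and "h \<ge> 2" and "t \<ge> 1"
  shows "bij_betw (successive_differences m)
    {x \<in> rulers m t. is_Bh_set h m x}
    {z \<in> integer_lattice m \<inter> dilated_simplex_interior m (real_of_int t).
       \<forall>H\<in>Bh_hyperplanes h m. z \<notin> H}"
proof -
  have inj: "inj_on (successive_differences m) (rulers m t)"
    and img: "successive_differences m ` rulers m t =
      integer_lattice m \<inter> dilated_simplex_interior m (real_of_int t)"
    using bij_betw_successive_differences[OF assms(1)] by (auto simp: bij_betw_def)
  \<comment> \<open>With the lattice points written as the image of all rulers, the bijection
    restricts, since a ruler is a B_h-set exactly when its image avoids the hyperplanes.\<close>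
  show ?thesis
    unfolding img[symmetric]
    using is_Bh_set_iff_avoids_hyperplanes[OF assms(1) _ assms(3)]
    by (intro bij_betw_imageI inj_on_subset[OF inj]) auto
qed

end
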